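(* Let $(A,\cdot,+)$ be a linear cycle set and $\Gamma$ be an abelian group. Let the maps $\partial_n$, $\partial^n$ and the groups $RC_n(A;\Gamma)$, $RC^{\mathrm D}_n(A;\Gamma)$, $RC^n(A;\Gamma)$, $RC^n_{\mathrm N}(A;\Gamma)$ be as defined in the context. (1) The maps $\partial_\bullet$: square to zero, i.e. $\partial_{n-1}\partial_n=0$ for all $n>1$; induce maps $RC_n(A;\Gamma)\to RC_{n-1}(A;\Gamma)$; and these further restrict to maps $RC^{\mathrm D}_n(A;\Gamma)\to RC^{\mathrm D}_{n-1}(A;\Gamma)$. (2) The maps $\partial^\bullet$: square to zero, i.e. $\partial^{n+1}\partial^n=0$ for all $n\geqslant 1$; restrict to maps $RC^n(A;\Gamma)\to RC^{n+1}(A;\Gamma)$; and further restrict to maps $RC^n_{\mathrm N}(A;\Gamma)\to RC^{n+1}_{\mathrm N}(A;\Gamma)$.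
   Context: A cycle set is a set $X$ with a binary operation $\cdot$ such that all left translations $a\mapsto b\cdot a$ are bijective and $(a\cdot b)\cdot(a\cdot c)=(b\cdot a)\cdot(b\cdot c)$ for all $a,b,c$. A linear cycle set is a cycle set $(A,\cdot)$ with an abelian group operation $+$ satisfying $a\cdot(b+c)=a\cdot b+a\cdot c$ and $(a+b)\cdot c=(a\cdot b)\cdot(a\cdot c)$ for all $a,b,c\in A$. For $n>0$ write $\Gamma A^{\times n}=\Gamma\otimes_{\mathbb Z}\mathbb Z A^{\times n}\simeq\Gamma^{(A^{\times n})}$ (formal $\Gamma$-linear combinations of $n$-tuples). $RC_n(A;\Gamma)$ is the quotient of $\Gamma A^{\times n}$ by the relations $$\gamma(a_1,\ldots,a_{n-1},a_n+a_n')=\gamma(a_1,\ldots,a_{n-1},a_n)+\gamma(a_1,\ldots,a_{n-1},a_n').$$ $RC^{\mathrm D}_n(A;\Gamma)$ is the subgroup of $RC_n(A;\Gamma)$ generated by the elements $\gamma(a_1,\ldots,a_n)$ with $a_i=0$ for some $1\leqslant i\leqslant n$ (degenerate $n$-tuples). For $n>1$, $\partial_n\colon\Gamma A^{\times n}\to\Gamma A^{\times(n-1)}$ is the linearization of $$\partial_n(a_1,\ldots,a_n)=(a_1\cdot a_2,\ldots,a_1\cdot a_n)+\sum_{i=1}^{n-2}(-1)^i(a_1,\ldots,a_i+a_{i+1},\ldots,a_n)+(-1)^{n-1}(a_1,\ldots,a_{n-2},a_n),$$ and $\partial_1=0$. For $n>0$, $RC^n(A;\Gamma)$ is the group of maps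 $f\colon A^{\times n}\to\Gamma$ that are additive in the last coordinate, $f(a_1,\ldots,a_{n-1},a_n+a_n')=f(a_1,\ldots,a_{n-1},a_n)+f(a_1,\ldots,a_{n-1},a_n')$, and $RC^n_{\mathrm N}(A;\Gamma)\subset RC^n(A;\Gamma)$ consists of those vanishing on all $n$-tuples with some entry equal to $0$. For $n\geqslant1$, $\partial^n\colon\operatorname{Fun}(A^{\times n},\Gamma)\to\operatorname{Fun}(A^{\times(n+1)},\Gamma)$ (where $\operatorname{Fun}$ denotes the group of all maps) is $$(\partial^nf)(a_1,\ldots,a_{n+1})=f(a_1\cdot a_2,\ldots,a_1\cdot a_{n+1})+\sum_{i=1}^{n-1}(-1)^if(a_1,\ldots,a_i+a_{i+1},\ldots,a_{n+1})+(-1)^nf(a_1,\ldots,a_{n-1},a_{n+1}).$$ *)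

theory Defs
  imports "HOL-Algebra.Coset" "HOL-Algebra.Generated_Groups" "HOL-Library.Poly_Mapping"
begin

section \<open>Linear cycle sets\<close>

locale cycle_set =
  fixes dot :: "'a \<Rightarrow> 'a \<Rightarrow> 'a"  (infixl \<open>\<cdot>\<close> 70)
  assumes bij_left_translation: "bij (\<lambda>a. b \<cdot> a)"
    and cycle: "(a \<cdot> b) \<cdot> (a \<cdot> c) = (b \<cdot> a) \<cdot> (b \<cdot> c)"

locale linear_cycle_set = cycle_set dot
  for dot :: "'a::ab_group_add \<Rightarrow> 'a \<Rightarrow> 'a"  (infixl \<open>\<cdot>\<close> 70) +
  assumes dot_add_right: "a \<cdot> (b + c) = a \<cdot> b + a \<cdot> c"
    and dot_add_left: "(a + b) \<cdot> c = (a \<cdot> b) \<cdot> (a \<cdot> c)"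


section \<open>Operations on tuples\<close>

text \<open>An \<open>n\<close>-tuple \<open>(a\<^sub>1, \<dots>, a\<^sub>n)\<close> is a list of length \<open>n\<close>, with \<open>a\<^sub>i = as ! (i - 1)\<close>.\<close>

definition tuples :: "nat \<Rightarrow> 'a list set" where
  "tuples n = {as. length as = n}"

definition act_first :: "('a \<Rightarrow> 'a \<Rightarrow> 'a) \<Rightarrow> 'a list \<Rightarrow> 'a list" where
  "act_first dot as = map (dot (hd as)) (tl as)"

text \<open>\<open>(a\<^sub>1, \<dots>, a\<^sub>i + a\<^sub>i\<^sub>+\<^sub>1, \<dots>, a\<^sub>n)\<close>, the index \<open>i\<close> counting from 1.\<close>

definition merge_at :: "nat \<Rightarrow> 'a::plus list \<Rightarrow> 'a list" where
  "merge_at i as = take (i - 1) as @ [as ! (i - 1) + as ! i] @ drop (i + 1) as"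

text \<open>\<open>(a\<^sub>1, \<dots>, a\<^sub>n\<^sub>-\<^sub>2, a\<^sub>n)\<close>.\<close>

definition omit_penultimate :: "'a list \<Rightarrow> 'a list" where
  "omit_penultimate as = take (length as - 2) as @ [last as]"

text \<open>\<open>(-1)\<^sup>i \<gamma>\<close> in an abelian group without multiplication.\<close>

definition alt_sign :: "nat \<Rightarrow> 'g::ab_group_add \<Rightarrow> 'g" where
  "alt_sign i \<gamma> = (if even i then \<gamma> else - \<gamma>)"


section \<open>Chains\<close>

text \<open>\<open>\<Gamma>A\<^sup>n\<close>: the element \<open>\<gamma>(a\<^sub>1, \<dots>, a\<^sub>n)\<close> is \<open>Poly_Mapping.single [a\<^sub>1, \<dots>, a\<^sub>n] \<gamma>\<close>.\<close>

definition chain_group :: "nat \<Rightarrow> ('a list \<Rightarrow>\<^sub>0 'g::ab_group_add) monoid" where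
  "chain_group n = \<lparr>carrier = {x. Poly_Mapping.keys x \<subseteq> tuples n}, mult = (+), one = 0\<rparr>"

definition RC_relations :: "nat \<Rightarrow> ('a::ab_group_add list \<Rightarrow>\<^sub>0 'g::ab_group_add) set" where
  "RC_relations n = generate (chain_group n)
     {Poly_Mapping.single (as @ [a + a']) \<gamma>
        - (Poly_Mapping.single (as @ [a]) \<gamma> + Poly_Mapping.single (as @ [a']) \<gamma>)
      | as a a' \<gamma>. length as + 1 = n}"

definition RC_chains :: "nat \<Rightarrow> ('a::ab_group_add list \<Rightarrow>\<^sub>0 'g::ab_group_add) set monoid" where
  "RC_chains n = chain_group n Mod RC_relations n"

definition RC_class ::
    "nat \<Rightarrow> ('a::ab_group_add list \<Rightarrow>\<^sub>0 'g::ab_group_add) \<Rightarrow> ('a list \<Rightarrow>\<^sub>0 'g) set" where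
  "RC_class n x = RC_relations n #>\<^bsub>chain_group n\<^esub> x"

definition RC_degenerate :: "nat \<Rightarrow> ('a::ab_group_add list \<Rightarrow>\<^sub>0 'g::ab_group_add) set monoid" where
  "RC_degenerate n = RC_chains n
     \<lparr>carrier := generate (RC_chains n)
        {RC_class n (Poly_Mapping.single as \<gamma>) | as \<gamma>. as \<in> tuples n \<and> 0 \<in> set as}\<rparr>"

definition boundary_gen ::
    "('a::ab_group_add \<Rightarrow> 'a \<Rightarrow> 'a) \<Rightarrow> nat \<Rightarrow> 'a list \<Rightarrow> 'g::ab_group_add \<Rightarrow> ('a list \<Rightarrow>\<^sub>0 'g)" where
  "boundary_gen dot n as \<gamma> =
     Poly_Mapping.single (act_first dot as) \<gamma>
     + (\<Sum>i=1..n-2. Poly_Mapping.single (merge_at i as) (alt_sign i \<gamma>))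
     + Poly_Mapping.single (omit_penultimate as) (alt_sign (n - 1) \<gamma>)"

text \<open>\<open>\<partial>\<^sub>n\<close>, the linear extension of its values on the \<open>\<gamma>(a\<^sub>1, \<dots>, a\<^sub>n)\<close>;
  \<open>\<partial>\<^sub>1 = 0\<close> by convention.\<close>

definition boundary ::
    "('a::ab_group_add \<Rightarrow> 'a \<Rightarrow> 'a) \<Rightarrow> nat \<Rightarrow> ('a list \<Rightarrow>\<^sub>0 'g::ab_group_add) \<Rightarrow> ('a list \<Rightarrow>\<^sub>0 'g)" where
  "boundary dot n x =
     (if n \<le> 1 then 0
      else \<Sum>as\<in>Poly_Mapping.keys x. boundary_gen dot n as (Poly_Mapping.lookup x as))"


section \<open>Cochains\<close>

text \<open>\<open>Fun(A\<^sup>n, \<Gamma>)\<close>: maps are \<open>undefined\<close> outside \<open>tuples n\<close>, so that two of them are equal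
  iff they agree on all \<open>n\<close>-tuples.\<close>

definition fun_group :: "nat \<Rightarrow> ('a list \<Rightarrow> 'g::ab_group_add) monoid" where
  "fun_group n = \<lparr>carrier = tuples n \<rightarrow>\<^sub>E UNIV,
     mult = (\<lambda>f g. \<lambda>as\<in>tuples n. f as + g as), one = (\<lambda>as\<in>tuples n. 0)\<rparr>"

definition RC_cochains :: "nat \<Rightarrow> ('a::ab_group_add list \<Rightarrow> 'g::ab_group_add) monoid" where
  "RC_cochains n = fun_group n
     \<lparr>carrier := {f \<in> carrier (fun_group n).
        \<forall>as a a'. length as + 1 = n \<longrightarrow> f (as @ [a + a']) = f (as @ [a]) + f (as @ [a'])}\<rparr>"

definition RC_normalized :: "nat \<Rightarrow> ('a::ab_group_add list \<Rightarrow> 'g::ab_group_add) monoid" where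
  "RC_normalized n = RC_cochains n
     \<lparr>carrier := {f \<in> carrier (RC_cochains n). \<forall>as\<in>tuples n. 0 \<in> set as \<longrightarrow> f as = 0}\<rparr>"

definition coboundary ::
    "('a::ab_group_add \<Rightarrow> 'a \<Rightarrow> 'a) \<Rightarrow> nat \<Rightarrow> ('a list \<Rightarrow> 'g::ab_group_add) \<Rightarrow> 'a list \<Rightarrow> 'g" where
  "coboundary dot n f = (\<lambda>as\<in>tuples (n + 1).
     f (act_first dot as)
     + (\<Sum>i=1..n-1. alt_sign i (f (merge_at i as)))
     + alt_sign n (f (omit_penultimate as)))"


section \<open>Well-definedness of the complexes\<close>

lemma comm_group_chain_group:
  "comm_group (chain_group n :: ('a list \<Rightarrow>\<^sub>0 'g::ab_group_add) monoid)"
proof (rule comm_groupI)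
  fix x :: "'a list \<Rightarrow>\<^sub>0 'g" assume "x \<in> carrier (chain_group n)"
  then show "\<exists>y\<in>carrier (chain_group n). y \<otimes>\<^bsub>chain_group n\<^esub> x = \<one>\<^bsub>chain_group n\<^esub>"
    by (intro bexI[of _ "- x"]) (auto simp: chain_group_def)
next
  fix x y :: "'a list \<Rightarrow>\<^sub>0 'g"
  assume "x \<in> carrier (chain_group n)" "y \<in> carrier (chain_group n)"
  then show "x \<otimes>\<^bsub>chain_group n\<^esub> y \<in> carrier (chain_group n)"
    using keys_add[of x y] by (auto simp: chain_group_def)
qed (auto simp: chain_group_def algebra_simps)

lemma normal_RC_relations:
  "(RC_relations n :: ('a::ab_group_add list \<Rightarrow>\<^sub>0 'g::ab_group_add) set) \<lhd> chain_group n"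
proof -
  interpret G: comm_group "chain_group n :: ('a list \<Rightarrow>\<^sub>0 'g) monoid"
    by (rule comm_group_chain_group)
  have gens: "Poly_Mapping.single (as @ [a + a']) \<gamma>
      - (Poly_Mapping.single (as @ [a]) \<gamma> + Poly_Mapping.single (as @ [a']) \<gamma>)
    \<in> carrier (chain_group n)" if "length as + 1 = n" for as :: "'a list" and a a' and \<gamma> :: 'g
  proof -
    have s: "Poly_Mapping.keys (Poly_Mapping.single (as @ [b]) \<gamma>) \<subseteq> tuples n" for b
      using that by (simp add: tuples_def)
    show ?thesis unfolding chain_group_def
      by (auto dest!: subsetD[OF keys_diff] subsetD[OF keys_add] subsetD[OF s])
  qed
  have "subgroup (RC_relations n) (chain_group n :: ('a list \<Rightarrow>\<^sub>0 'g) monoid)"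
    unfolding RC_relations_def using gens by (intro G.generate_is_subgroup) blast
  then show ?thesis by (rule G.normal_iff_subgroup[THEN iffD2])
qed

lemma alt_sign_add: "alt_sign i (x + y) = alt_sign i x + alt_sign i y"
  by (simp add: alt_sign_def)

lemma boundary_gen_add:
  "boundary_gen dot n as (\<gamma> + \<gamma>') = boundary_gen dot n as \<gamma> + boundary_gen dot n as \<gamma>'"
  by (simp add: boundary_gen_def alt_sign_add single_add sum.distrib algebra_simps)

lemma boundary_gen_zero: "boundary_gen dot n as 0 = 0"
  using boundary_gen_add[of dot n as 0 0] by simp

lemma boundary_single: "n > 1 \<Longrightarrow> boundary dot n (Poly_Mapping.single as \<gamma>) = boundary_gen dot n as \<gamma>"
  by (simp add: boundary_def boundary_gen_zero)

lemma boundary_superset: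
  assumes "n > 1" "finite S" "Poly_Mapping.keys x \<subseteq> S"
  shows "boundary dot n x = (\<Sum>as\<in>S. boundary_gen dot n as (Poly_Mapping.lookup x as))"
  using assms by (auto simp: boundary_def in_keys_iff boundary_gen_zero intro!: sum.mono_neutral_left)

lemma boundary_add: "boundary dot n (x + y) = boundary dot n x + boundary dot n y"
proof (cases "n > 1")
  case True
  let ?S = "Poly_Mapping.keys x \<union> Poly_Mapping.keys y"
  show ?thesis using True keys_add[of x y]
    by (simp add: boundary_superset[of n ?S] lookup_add boundary_gen_add sum.distrib)
qed (simp add: boundary_def)

lemma keys_boundary_gen:
  fixes dot :: "'a::ab_group_add \<Rightarrow> 'a \<Rightarrow> 'a" and \<gamma> :: "'g::ab_group_add"
  assumes "n > 1" "as \<in> tuples n"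
  shows "Poly_Mapping.keys (boundary_gen dot n as \<gamma>) \<subseteq> tuples (n - 1)"
proof -
  have s: "Poly_Mapping.keys (Poly_Mapping.single bs \<delta>) \<subseteq> tuples (n - 1)"
    if "length bs = n - 1" for bs :: "'a list" and \<delta> :: 'g
    using that by (simp add: tuples_def)
  have m: "Poly_Mapping.keys (\<Sum>i=1..n-2. Poly_Mapping.single (merge_at i as) (alt_sign i \<gamma>))
      \<subseteq> tuples (n - 1)"
    using assms
    by (intro order_trans[OF keys_sum] UN_least s) (auto simp: merge_at_def tuples_def)
  show ?thesis unfolding boundary_gen_def using assms m
    by (intro order_trans[OF keys_add] Un_least s m)
      (auto simp: act_first_def omit_penultimate_def tuples_def)
qed

lemma boundary_hom:
  fixes dot :: "'a::ab_group_add \<Rightarrow> 'a \<Rightarrow> 'a"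
  assumes "n > 1"
  shows "boundary dot n \<in>
    hom (chain_group n :: ('a list \<Rightarrow>\<^sub>0 'g::ab_group_add) monoid) (chain_group (n - 1))"
proof -
  have "Poly_Mapping.keys (boundary dot n x) \<subseteq> tuples (n - 1)"
    if "Poly_Mapping.keys x \<subseteq> tuples n" for x :: "'a list \<Rightarrow>\<^sub>0 'g"
  proof -
    have "Poly_Mapping.keys (\<Sum>as\<in>Poly_Mapping.keys x.
        boundary_gen dot n as (Poly_Mapping.lookup x as)) \<subseteq> tuples (n - 1)"
      using that assms by (intro order_trans[OF keys_sum] UN_least keys_boundary_gen) auto
    then show ?thesis using assms by (simp add: boundary_def)
  qed
  then show ?thesis by (simp add: hom_def chain_group_def boundary_add)
qed

lemma comm_group_fun_group:
  "comm_group (fun_group n :: ('a list \<Rightarrow> 'g::ab_group_add) monoid)"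
proof (rule comm_groupI)
  fix f :: "'a list \<Rightarrow> 'g" assume "f \<in> carrier (fun_group n)"
  then show "\<exists>g\<in>carrier (fun_group n). g \<otimes>\<^bsub>fun_group n\<^esub> f = \<one>\<^bsub>fun_group n\<^esub>"
    by (intro bexI[of _ "\<lambda>as\<in>tuples n. - f as"]) (auto simp: fun_group_def)
qed (auto simp: fun_group_def fun_eq_iff PiE_def extensional_def algebra_simps)

lemma coboundary_hom:
  fixes dot :: "'a::ab_group_add \<Rightarrow> 'a \<Rightarrow> 'a"
  assumes "n \<ge> 1"
  shows "coboundary dot n \<in> hom (fun_group n :: ('a list \<Rightarrow> 'g::ab_group_add) monoid) (fun_group (n + 1))"
proof -
  have [simp]: "act_first dot as \<in> tuples n" "omit_penultimate as \<in> tuples n"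
    if "as \<in> tuples (n + 1)" for as
    using that assms by (auto simp: tuples_def act_first_def omit_penultimate_def)
  have [simp]: "merge_at i as \<in> tuples n" if "as \<in> tuples (n + 1)" "1 \<le> i" "i \<le> n - 1" for i as
    using that assms by (auto simp: tuples_def merge_at_def)
  show ?thesis
    by (auto simp: hom_def fun_group_def coboundary_def fun_eq_iff alt_sign_add sum.distrib
        restrict_def simp del: One_nat_def)
qed

end

theory Submission
  imports Defs
begin

text \<open>
  Both differentials are alternating sums over the same face maps \<open>d\<^sub>0, \<dots>, d\<^sub>n\<^sub>-\<^sub>1\<close> on \<open>n\<close>-tuples:
  \<open>d\<^sub>0\<close> acts by the first entry, \<open>d\<^sub>i\<close> adds the neighbours \<open>a\<^sub>i, a\<^sub>i\<^sub>+\<^sub>1\<close>, and \<open>d\<^sub>n\<^sub>-\<^sub>1\<close> omits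
  \<open>a\<^sub>n\<^sub>-\<^sub>1\<close>. They satisfy the presimplicial identities \<open>d\<^sub>i d\<^sub>j = d\<^sub>j\<^sub>-\<^sub>1 d\<^sub>i\<close> for \<open>i < j\<close>, so the
  differentials square to zero. Every face map is additive in the last entry, which gives
  compatibility with the linearity relations. If \<open>a\<^sub>k = 0\<close> with \<open>k < n\<close>, then \<open>d\<^sub>k\<^sub>-\<^sub>1\<close> and \<open>d\<^sub>k\<close>
  agree on the tuple and cancel, while all other faces still contain a zero; if \<open>a\<^sub>n = 0\<close>, all
  faces end in zero.
\<close>

section \<open>Face maps and the presimplicial identity\<close>

text \<open>Numbering faces from \<open>0\<close> leaves the index of \<open>merge_at\<close>
  unchanged and makes every sign \<open>alt_sign i\<close>. The length is read off the list, so one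
  function serves all degrees; on a pair there is no merge, and face \<open>1\<close> is already the
  omission.\<close>

definition face :: "('a::plus \<Rightarrow> 'a \<Rightarrow> 'a) \<Rightarrow> nat \<Rightarrow> 'a list \<Rightarrow> 'a list" where
  "face dot i as =
     (if i = 0 then act_first dot as
      else if i < length as - 1 then merge_at i as
      else omit_penultimate as)"

lemma length_face:
  assumes "2 \<le> length as" "i < length as"
  shows "length (face dot i as) = length as - 1"
  using assms by (auto simp: face_def act_first_def merge_at_def omit_penultimate_def)

lemma face_in_tuples: "as \<in> tuples n \<Longrightarrow> 2 \<le> n \<Longrightarrow> i < n \<Longrightarrow> face dot i as \<in> tuples (n - 1)"
  by (simp add: tuples_def length_face)

text \<open>Reduces identities between faces to case distinctions on entries. The last face looks
  like a merge, except that at position \<open>i - 1\<close> the sum is replaced by its second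
  summand.\<close>

lemma nth_face:
  assumes "2 \<le> length as" "i < length as" "k < length as - 1"
  shows "face dot i as ! k =
    (if i = 0 then dot (as ! 0) (as ! Suc k)
     else if Suc k < i then as ! k
     else if Suc k = i \<and> i < length as - 1 then as ! k + as ! i
     else as ! Suc k)"
proof -
  consider "i = 0" | "0 < i" "i < length as - 1" | "0 < i" "i = length as - 1"
    using assms by linarith
  then show ?thesis
  proof cases
    case 1
    then show ?thesis using assms by (cases as) (simp_all add: face_def act_first_def)
  next
    case 2
    then have face: "face dot i as ! k = (if k < i - 1 then as ! k
        else ((as ! (i - 1) + as ! i) # drop (i + 1) as) ! (k - (i - 1)))"
      by (simp add: face_def merge_at_def nth_append)
    consider "Suc k < i" | "i = Suc k" | "i \<le> k" by linarith
    then show ?thesis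
    proof cases
      case 3
      \<comment> \<open>Exposes the \<open>Suc\<close> that steps over the merged entry at the head
        of the list.\<close>
      then have "k - (i - 1) = Suc (k - i)" using 2 by linarith
      moreover have "\<not> k < i - 1" using 3 by linarith
      ultimately show ?thesis using 2 3 assms face by simp
    qed (use 2 face in auto)
  next
    case 3
    then have "face dot i as = take (length as - 2) as @ [as ! (length as - 1)]"
      using assms by (cases as rule: rev_cases) (auto simp: face_def omit_penultimate_def)
    \<comment> \<open>Together with the bound on \<open>k\<close>, the condition leaves only
      \<open>k = length as - 2\<close>.\<close>
    moreover have "as ! (length as - 1) = as ! Suc k" if "\<not> k < length as - 2"
      using that assms by (intro arg_cong[of _ _ "(!) as"]) linarith
    moreover have "Suc k < i \<longleftrightarrow> k < length as - 2" using 3 by linarith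
    ultimately show ?thesis
      using 3 assms by (simp add: nth_append)
  qed
qed

text \<open>Separates the last entry from the rest: \<phi> is translation by the first entry for
  face \<open>0\<close> and the identity otherwise. Additivity of faces in the last entry is used in
  this form for both chains and cochains.\<close>

lemma face_snoc:
  assumes "linear_cycle_set dot" "as \<noteq> []" "i \<le> length as"
  obtains bs \<phi> where "length bs = length as - 1" "\<And>a a'. \<phi> (a + a') = \<phi> a + \<phi> a'"
    "\<And>a. face dot i (as @ [a]) = bs @ [\<phi> a]"
proof -
  interpret linear_cycle_set dot by fact
  consider "i = 0" | "0 < i" "i < length as" | "0 < i" "i = length as" using assms by linarith
  then show thesis
  proof cases
    case 1
    show thesis
    proof
      show "face dot i (as @ [a]) = map (dot (hd as)) (tl as) @ [dot (hd as) a]" for a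
        using 1 assms by (simp add: face_def act_first_def)
    qed (use assms in \<open>auto simp: dot_add_right\<close>)
  next
    case 2
    show thesis
    proof
      \<comment> \<open>A merge reaches at most the last entry of \<open>as\<close>, so
        \<open>a\<close> stays untouched.\<close>
      show "face dot i (as @ [a]) = merge_at i as @ [a]" for a
        using 2 assms by (auto simp: face_def merge_at_def nth_append)
    qed (use assms 2 in \<open>auto simp: merge_at_def\<close>)
  next
    case 3
    show thesis
    proof
      show "face dot i (as @ [a]) = butlast as @ [a]" for a
        using 3 assms by (auto simp: face_def omit_penultimate_def butlast_conv_take)
    qed auto
  qed
qed

text \<open>For \<open>i = j = 0\<close> this is \<open>dot_add_left\<close>, for
  \<open>i = 0 < j\<close> it rests on \<open>dot_add_right\<close>, for \<open>0 < i = j\<close> on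
  associativity of addition; otherwise the two faces change disjoint places. Using
  \<open>Suc j\<close> avoids a subtraction.\<close>

lemma face_face:
  assumes "linear_cycle_set dot" "3 \<le> length as" "i \<le> j" "Suc j < length as"
  shows "face dot i (face dot (Suc j) as) = face dot j (face dot i as)"
proof (rule nth_equalityI)
  interpret linear_cycle_set dot by fact
  have len: "length (face dot i as) = length as - 1" "length (face dot (Suc j) as) = length as - 1"
    using assms by (simp_all add: length_face)
  show "length (face dot i (face dot (Suc j) as)) = length (face dot j (face dot i as))"
    using assms by (simp add: length_face)
  fix k assume "k < length (face dot i (face dot (Suc j) as))"
  then have "k < length as - 2" using assms by (simp add: length_face)
  then show "face dot i (face dot (Suc j) as) ! k = face dot j (face dot i as) ! k"
    using assms len
    by (cases "i = 0"; cases "j = 0")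
      (auto simp: nth_face dot_add_left dot_add_right add.assoc simp del: length_greater_0_conv)
qed

section \<open>Faces of tuples with a zero entry\<close>

context linear_cycle_set
begin

lemma dot_zero_right: "a \<cdot> 0 = 0"
  using dot_add_right[of a 0 0] by simp

text \<open>Since \<open>0 + 0 = 0\<close> and \<open>0 \<cdot> 0 = 0\<close>, translation by
  \<open>0\<close> is idempotent; being injective, it is the identity.\<close>

lemma dot_zero_left: "0 \<cdot> a = a"
proof -
  have "0 \<cdot> (0 \<cdot> a) = 0 \<cdot> a"
    using dot_add_left[of 0 0 a] by (simp add: dot_zero_right)
  then show ?thesis
    using bij_left_translation[of 0] by (metis bij_pointE)
qed

end

text \<open>Both faces merely delete the zero: acting by it, adding it to either neighbour and
  omitting it as penultimate entry have the same effect. Positions count from \<open>0\<close>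
  here.\<close>

lemma face_zero_eq:
  assumes "linear_cycle_set dot" "Suc k < length as" "as ! k = 0"
  shows "face dot k as = face dot (Suc k) as"
proof (rule nth_equalityI)
  interpret linear_cycle_set dot by fact
  show "length (face dot k as) = length (face dot (Suc k) as)"
    using assms by (simp add: length_face)
  fix l assume "l < length (face dot k as)"
  then have "l < length as - 1" using assms by (simp add: length_face)
  then show "face dot k as ! l = face dot (Suc k) as ! l"
    using assms
    by (cases "l = k"; cases "Suc l = k") (auto simp: nth_face dot_zero_left)
qed

text \<open>The zero keeps its position if the face operates to its right, and otherwise moves one
  place to the left, where face \<open>0\<close> preserves it by
  \<open>dot_zero_right\<close>.\<close>

lemma zero_in_face:
  assumes "linear_cycle_set dot" "2 \<le> length as" "i < length as" "k < length as" "as ! k = 0"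
    and "k = length as - 1 \<or> i \<noteq> k \<and> i \<noteq> Suc k"
  shows "0 \<in> set (face dot i as)"
proof -
  interpret linear_cycle_set dot by fact
  have len: "length (face dot i as) = length as - 1" using assms by (simp add: length_face)
  show ?thesis
  proof (cases "k < i \<and> k < length as - 1")
    case True
    \<comment> \<open>Here \<open>i\<close> is at least \<open>k + 2\<close>, so position
      \<open>k\<close> precedes every change.\<close>
    then have "face dot i as ! k = 0" using assms by (auto simp: nth_face)
    moreover have "k < length (face dot i as)" using True len by simp
    ultimately show ?thesis by (metis nth_mem)
  next
    case False
    \<comment> \<open>With \<open>k = 0\<close> the negated condition would give
      \<open>i = 0\<close>, which is excluded because \<open>k\<close> is not the last
      position.\<close>
    then have "k > 0" using assms by auto
    then have "face dot i as ! (k - 1) = 0"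
      using assms False by (auto simp: nth_face dot_zero_right)
    moreover have "k - 1 < length (face dot i as)" using \<open>k > 0\<close> assms len by simp
    ultimately show ?thesis by (metis nth_mem)
  qed
qed

section \<open>Alternating sums over faces\<close>

lemma alt_sign_zero [simp]: "alt_sign i 0 = 0"
  by (simp add: alt_sign_def)

lemma alt_sign_sum: "alt_sign i (\<Sum>x\<in>S. f x) = (\<Sum>x\<in>S. alt_sign i (f x))"
  by (simp add: alt_sign_def sum_negf)

lemma single_alt_sign:
  "Poly_Mapping.single as (alt_sign i \<gamma>) = alt_sign i (Poly_Mapping.single as \<gamma>)"
  by (simp add: alt_sign_def single_uminus)

text \<open>The arbitrary \<open>G\<close> lets one computation serve both differentials: it becomes
  \<open>Poly_Mapping.single\<close> with a fixed coefficient for chains, and the cochain itself for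
  cochains.\<close>

lemma sum_faces:
  fixes G :: "'a::ab_group_add list \<Rightarrow> 'h::ab_group_add"
  assumes "length as = n" "2 \<le> n"
  shows "(\<Sum>i<n. alt_sign i (G (face dot i as))) =
    G (act_first dot as) + (\<Sum>i=1..n-2. alt_sign i (G (merge_at i as)))
      + alt_sign (n - 1) (G (omit_penultimate as))"
proof -
  have faces: "face dot 0 as = act_first dot as" "face dot (n - 1) as = omit_penultimate as"
    "\<And>i. i \<in> {1..n-2} \<Longrightarrow> face dot i as = merge_at i as"
    using assms by (auto simp: face_def)
  \<comment> \<open>The first and last faces are split off; for \<open>n = 2\<close> the middle
    range is empty.\<close>
  have "{..<n} = insert 0 (insert (n - 1) {1..n-2})" using assms by auto
  moreover have "n - 1 \<notin> {1..n-2}" "0 \<notin> insert (n - 1) {1..n-2}" using assms by auto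
  ultimately have "(\<Sum>i<n. alt_sign i (G (face dot i as))) = G (face dot 0 as)
      + (alt_sign (n - 1) (G (face dot (n - 1) as))
      + (\<Sum>i=1..n-2. alt_sign i (G (face dot i as))))"
    using assms by (simp add: alt_sign_def[of 0] del: One_nat_def)
  also have "(\<Sum>i=1..n-2. alt_sign i (G (face dot i as)))
      = (\<Sum>i=1..n-2. alt_sign i (G (merge_at i as)))"
    by (intro sum.cong) (simp_all only: faces)
  finally show ?thesis by (simp only: faces ac_simps)
qed

text \<open>The terms cancel in pairs: \<open>face_face\<close> identifies the tuples at
  \<open>(j, i)\<close> and \<open>(i, j - 1)\<close> for \<open>i < j\<close>, and their signs are
  opposite.\<close>

lemma double_sum_faces:
  fixes G :: "'a::ab_group_add list \<Rightarrow> 'h::ab_group_add"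
  assumes "linear_cycle_set dot" "length as = n" "3 \<le> n"
  shows "(\<Sum>j<n. \<Sum>i<n-1. alt_sign j (alt_sign i (G (face dot i (face dot j as))))) = 0"
    (is "(\<Sum>j<n. \<Sum>i<n-1. ?t j i) = 0")
proof -
  let ?T = "\<lambda>(j, i). ?t j i"
  let ?U = "{(j, i). j < n \<and> i < j}" and ?L = "{(j, i). i < n - 1 \<and> j \<le> i}"
  have "(\<Sum>j<n. \<Sum>i<n-1. ?t j i) = sum ?T ({..<n} \<times> {..<n-1})"
    by (simp add: sum.cartesian_product)
  also have "{..<n} \<times> {..<n-1} = ?U \<union> ?L" by auto
  also have "sum ?T (?U \<union> ?L) = sum ?T ?U + sum ?T ?L"
  proof (rule sum.union_disjoint)
    show "finite ?U" by (rule finite_subset[of _ "{..<n} \<times> {..<n}"]) auto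
    show "finite ?L" by (rule finite_subset[of _ "{..<n} \<times> {..<n}"]) auto
  qed auto
  also have "sum ?T ?U = sum (\<lambda>p. - ?T p) ?L"
  \<comment> \<open>The witnesses are the mutually inverse maps between the two halves of the index
    set given by the presimplicial identity.\<close>
  proof (rule sum.reindex_bij_witness[of _ "\<lambda>(j, i). (Suc i, j)" "\<lambda>(j, i). (i, j - 1)"])
    fix p assume "p \<in> ?U"
    then obtain j i where p: "p = (j, i)" "i < j" "j < n" by auto
    then obtain l where l: "j = Suc l" by (cases j) auto
    then have "face dot i (face dot j as) = face dot l (face dot i as)"
      using p assms by (simp add: face_face)
    then show "- ?T (case p of (j, i) \<Rightarrow> (i, j - 1)) = ?T p"
      using p l by (auto simp: alt_sign_def)
  qed auto
  also have "\<dots> + sum ?T ?L = 0" by (simp add: sum_negf)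
  finally show ?thesis .
qed

text \<open>\<open>S\<close> collects the faces left after cancellation: all of them if the zero is
  the last entry, otherwise all except the two equal neighbours from \<open>face_zero_eq\<close>,
  whose signs are opposite.\<close>

lemma sum_faces_degenerate:
  fixes G :: "'a::ab_group_add list \<Rightarrow> 'h::ab_group_add"
  assumes "linear_cycle_set dot" "length as = n" "2 \<le> n" "0 \<in> set as"
  obtains S where "S \<subseteq> {..<n}" "\<And>i. i \<in> S \<Longrightarrow> 0 \<in> set (face dot i as)"
    "(\<Sum>i<n. alt_sign i (G (face dot i as))) = (\<Sum>i\<in>S. alt_sign i (G (face dot i as)))"
proof -
  obtain k where k: "k < n" "as ! k = 0" using assms by (metis in_set_conv_nth)
  show thesis
  proof (cases "k = n - 1")
    case True
    show thesis
    proof (rule that[of "{..<n}"])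
      show "0 \<in> set (face dot i as)" if "i \<in> {..<n}" for i
        using that assms k True by (intro zero_in_face[of _ _ _ k]) auto
    qed auto
  next
    case False
    let ?S = "{..<n} - {k, Suc k}"
    show thesis
    proof (rule that[of ?S])
      show "0 \<in> set (face dot i as)" if "i \<in> ?S" for i
        using that assms k by (intro zero_in_face[of _ _ _ k]) auto
      have "face dot k as = face dot (Suc k) as"
        using assms k False by (intro face_zero_eq) auto
      then have "(\<Sum>i\<in>{k, Suc k}. alt_sign i (G (face dot i as))) = 0"
        by (simp add: alt_sign_def)
      moreover have "{k, Suc k} \<subseteq> {..<n}" using k False by auto
      ultimately show "(\<Sum>i<n. alt_sign i (G (face dot i as)))
          = (\<Sum>i\<in>?S. alt_sign i (G (face dot i as)))"
        by (simp add: sum.subset_diff[of "{k, Suc k}" "{..<n}"])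
    qed auto
  qed
qed

section \<open>The boundary squares to zero\<close>

lemma boundary_gen_faces:
  assumes "as \<in> tuples n" "2 \<le> n"
  shows "boundary_gen dot n as \<gamma> = (\<Sum>i<n. Poly_Mapping.single (face dot i as) (alt_sign i \<gamma>))"
  using sum_faces[of as n "\<lambda>bs. Poly_Mapping.single bs \<gamma>" dot] assms
  by (simp add: boundary_gen_def single_alt_sign tuples_def)

lemma coboundary_faces:
  assumes "as \<in> tuples (n + 1)" "1 \<le> n"
  shows "coboundary dot n f as = (\<Sum>i<n+1. alt_sign i (f (face dot i as)))"
  using sum_faces[of as "n + 1" f dot] assms by (simp add: coboundary_def tuples_def)

lemma boundary_sum: "boundary dot n (\<Sum>i\<in>S. x i) = (\<Sum>i\<in>S. boundary dot n (x i))"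
proof -
  have "boundary dot n 0 = 0" by (simp add: boundary_def)
  then show ?thesis
    by (induction S rule: infinite_finite_induct) (simp_all add: boundary_add)
qed

lemma boundary_diff: "boundary dot n (x - y) = boundary dot n x - boundary dot n y"
  using boundary_add[of dot n "x - y" y] by (simp add: eq_diff_eq)

lemma sum_single_keys:
  "(\<Sum>as\<in>Poly_Mapping.keys x. Poly_Mapping.single as (Poly_Mapping.lookup x as)) = x"
  by (rule poly_mapping_eqI)
    (simp add: lookup_sum lookup_single when_def in_keys_iff sum.delta' sum.delta)

lemma boundary_boundary:
  fixes x :: "'a::ab_group_add list \<Rightarrow>\<^sub>0 'g::ab_group_add"
  assumes "linear_cycle_set dot" "n > 1" "x \<in> carrier (chain_group n)"
  shows "boundary dot (n - 1) (boundary dot n x) = 0"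
proof (cases "n = 2")
  case True
  \<comment> \<open>In degree \<open>2\<close> the outer map is \<open>boundary dot 1\<close>, zero
    by convention and not a sum of faces.\<close>
  then show ?thesis by (simp add: boundary_def)
next
  case False
  then have n: "3 \<le> n" using assms by simp
  have single: "boundary dot (n - 1) (boundary dot n (Poly_Mapping.single as \<gamma>)) = 0"
    if as: "as \<in> tuples n" for as and \<gamma> :: 'g
  proof -
    have "boundary dot (n - 1) (boundary dot n (Poly_Mapping.single as \<gamma>))
      = (\<Sum>j<n. boundary_gen dot (n - 1) (face dot j as) (alt_sign j \<gamma>))"
      using n as by (simp add: boundary_single boundary_gen_faces boundary_sum)
    also have "\<dots> = (\<Sum>j<n. \<Sum>i<n-1.
        alt_sign j (alt_sign i (Poly_Mapping.single (face dot i (face dot j as)) \<gamma>)))"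
    proof (rule sum.cong[OF refl])
      fix j assume "j \<in> {..<n}"
      then have "face dot j as \<in> tuples (n - 1)" using as n by (intro face_in_tuples) auto
      then show "boundary_gen dot (n - 1) (face dot j as) (alt_sign j \<gamma>) = (\<Sum>i<n-1.
          alt_sign j (alt_sign i (Poly_Mapping.single (face dot i (face dot j as)) \<gamma>)))"
        using n
        by (auto simp: boundary_gen_faces single_alt_sign alt_sign_def single_uminus intro!: sum.cong)
    qed
    also have "\<dots> = 0" using assms as n by (intro double_sum_faces) (auto simp: tuples_def)
    finally show ?thesis .
  qed
  \<comment> \<open>By additivity the claim passes from generators to arbitrary chains.\<close>
  have "boundary dot (n - 1) (boundary dot n x) = (\<Sum>as\<in>Poly_Mapping.keys x.
      boundary dot (n - 1) (boundary dot n (Poly_Mapping.single as (Poly_Mapping.lookup x as))))"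
    by (subst sum_single_keys[of x, symmetric], simp only: boundary_sum)
  also have "\<dots> = 0"
    using assms by (intro sum.neutral ballI single) (auto simp: chain_group_def)
  finally show ?thesis .
qed

section \<open>Descent to the quotient by the linearity relations\<close>

lemma subgroup_sum_closed:
  assumes "subgroup H (chain_group n)" "\<And>i. i \<in> S \<Longrightarrow> x i \<in> H"
  shows "(\<Sum>i\<in>S. x i) \<in> H"
  using assms(2)
proof (induction S rule: infinite_finite_induct)
  case (insert i S)
  then show ?case
    using subgroup.m_closed[OF assms(1), of "x i" "\<Sum>i\<in>S. x i"] by (simp add: chain_group_def)
\<comment> \<open>Empty sums, and by default infinite ones, are \<open>0\<close>, the neutral
  element.\<close>
qed (use subgroup.one_closed[OF assms(1)] in \<open>simp_all add: chain_group_def\<close>)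

lemma single_in_chain_group: "as \<in> tuples n \<Longrightarrow> Poly_Mapping.single as \<gamma> \<in> carrier (chain_group n)"
  by (simp add: chain_group_def)

lemma RC_class_hom: "RC_class n \<in> hom (chain_group n) (RC_chains n)"
  using normal.r_coset_hom_Mod[OF normal_RC_relations[of n]]
  by (simp add: RC_class_def[abs_def] RC_chains_def)

lemma group_RC_chains: "group (RC_chains n)"
  unfolding RC_chains_def by (rule normal.factorgroup_is_group[OF normal_RC_relations])

lemma RC_class_group_hom: "group_hom (chain_group n) (RC_chains n) (RC_class n)"
  by (intro group_hom.intro group_hom_axioms.intro RC_class_hom group_RC_chains
      comm_group.axioms(2) comm_group_chain_group)

text \<open>By \<open>face_snoc\<close> each face turns a relation into a relation one degree lower,
  so the boundary is a sum of relations with signed coefficients.\<close>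

lemma boundary_relation:
  fixes a a' :: "'a::ab_group_add" and \<gamma> :: "'g::ab_group_add"
  assumes "linear_cycle_set dot" "n > 1" "length as + 1 = n"
  shows "boundary dot n (Poly_Mapping.single (as @ [a + a']) \<gamma>
      - (Poly_Mapping.single (as @ [a]) \<gamma> + Poly_Mapping.single (as @ [a']) \<gamma>))
    \<in> RC_relations (n - 1)"
proof -
  have bd: "boundary dot n (Poly_Mapping.single (as @ [b]) \<gamma>)
      = (\<Sum>i<n. Poly_Mapping.single (face dot i (as @ [b])) (alt_sign i \<gamma>))" for b
    using assms by (simp add: boundary_single boundary_gen_faces tuples_def)
  have "Poly_Mapping.single (face dot i (as @ [a + a'])) (alt_sign i \<gamma>)
      - (Poly_Mapping.single (face dot i (as @ [a])) (alt_sign i \<gamma>)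
        + Poly_Mapping.single (face dot i (as @ [a'])) (alt_sign i \<gamma>)) \<in> RC_relations (n - 1)"
    if i: "i < n" for i
  proof -
    obtain bs \<phi> where "length bs = length as - 1" "\<And>a a'. \<phi> (a + a') = \<phi> a + \<phi> a'"
        "\<And>a. face dot i (as @ [a]) = bs @ [\<phi> a]"
      using assms i by (elim face_snoc[of dot as i]) auto
    moreover from this have "length bs + 1 = n - 1" using assms by auto
    ultimately show ?thesis
      unfolding RC_relations_def
      by (intro generate.incl CollectI exI[of _ bs] exI[of _ "\<phi> a"] exI[of _ "\<phi> a'"]
          exI[of _ "alt_sign i \<gamma>"]) simp
  qed
  then have "(\<Sum>i<n. Poly_Mapping.single (face dot i (as @ [a + a'])) (alt_sign i \<gamma>)
      - (Poly_Mapping.single (face dot i (as @ [a])) (alt_sign i \<gamma>)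
        + Poly_Mapping.single (face dot i (as @ [a'])) (alt_sign i \<gamma>))) \<in> RC_relations (n - 1)"
    by (intro subgroup_sum_closed[OF normal_imp_subgroup[OF normal_RC_relations]]) simp
  then show ?thesis
    by (simp only: boundary_diff boundary_add bd sum.distrib sum_subtractf)
qed

lemma RC_class_boundary_hom:
  assumes "n > 1"
  shows "group_hom (chain_group n :: ('a::ab_group_add list \<Rightarrow>\<^sub>0 'g::ab_group_add) monoid)
    (RC_chains (n - 1)) (\<lambda>x. RC_class (n - 1) (boundary dot n x))"
  using hom_compose[OF boundary_hom[OF assms] RC_class_hom]
  by (intro group_hom.intro group_hom_axioms.intro group_RC_chains
      comm_group.axioms(2) comm_group_chain_group) (simp add: comp_def)

text \<open>This is the condition for the boundary to factor through the quotient. The kernel is a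
  subgroup, so checking the generating relations suffices.\<close>

lemma RC_relations_kernel:
  assumes "linear_cycle_set dot" "n > 1"
  shows "(RC_relations n :: ('a::ab_group_add list \<Rightarrow>\<^sub>0 'g::ab_group_add) set)
    \<subseteq> kernel (chain_group n) (RC_chains (n - 1)) (\<lambda>x. RC_class (n - 1) (boundary dot n x))"
proof -
  interpret h: group_hom "chain_group n :: ('a list \<Rightarrow>\<^sub>0 'g) monoid" "RC_chains (n - 1)"
    "\<lambda>x. RC_class (n - 1) (boundary dot n x)"
    by (rule RC_class_boundary_hom[OF assms(2)])
  have sub: "RC_relations n \<subseteq> carrier (chain_group n :: ('a list \<Rightarrow>\<^sub>0 'g) monoid)"
    by (rule subgroup.subset[OF normal_imp_subgroup[OF normal_RC_relations]])
  show ?thesis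
    unfolding RC_relations_def
  proof (rule h.G.generate_subgroup_incl[OF _ h.subgroup_kernel], rule subsetI)
    fix x :: "'a list \<Rightarrow>\<^sub>0 'g"
    assume x: "x \<in> {Poly_Mapping.single (as @ [a + a']) \<gamma>
        - (Poly_Mapping.single (as @ [a]) \<gamma> + Poly_Mapping.single (as @ [a']) \<gamma>)
      | as a a' \<gamma>. length as + 1 = n}"
    then have "x \<in> RC_relations n" unfolding RC_relations_def by (rule generate.incl)
    then have "x \<in> carrier (chain_group n)" using sub by blast
    moreover have "boundary dot n x \<in> RC_relations (n - 1)"
      using x boundary_relation[OF assms] by blast
    \<comment> \<open>The coset of a relation is the relation subgroup itself, which is the neutral
      element of the quotient.\<close>
    then have "RC_class (n - 1) (boundary dot n x) = RC_relations (n - 1)"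
      unfolding RC_class_def
      by (intro subgroup.rcos_const normal_imp_subgroup normal_RC_relations
          comm_group.axioms(2) comm_group_chain_group)
    ultimately show "x \<in> kernel (chain_group n) (RC_chains (n - 1))
        (\<lambda>x. RC_class (n - 1) (boundary dot n x))"
      by (simp add: kernel_def RC_chains_def FactGroup_def)
  qed
qed

section \<open>The degenerate subgroup\<close>

abbreviation RC_degenerate_gens ::
    "nat \<Rightarrow> ('a::ab_group_add list \<Rightarrow>\<^sub>0 'g::ab_group_add) set set" where
  "RC_degenerate_gens n \<equiv>
     {RC_class n (Poly_Mapping.single as \<gamma>) | as \<gamma>. as \<in> tuples n \<and> 0 \<in> set as}"

lemma RC_degenerate_gens_carrier: "RC_degenerate_gens n \<subseteq> carrier (RC_chains n)"
  using hom_in_carrier[OF RC_class_hom] single_in_chain_group by blast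

lemma boundary_degenerate:
  fixes as :: "'a::ab_group_add list" and \<gamma> :: "'g::ab_group_add"
  assumes "linear_cycle_set dot" "n > 1" "as \<in> tuples n" "0 \<in> set as"
  shows "RC_class (n - 1) (boundary dot n (Poly_Mapping.single as \<gamma>))
    \<in> generate (RC_chains (n - 1)) (RC_degenerate_gens (n - 1))"
proof -
  interpret h: group_hom "chain_group (n - 1) :: ('a list \<Rightarrow>\<^sub>0 'g) monoid" "RC_chains (n - 1)"
    "RC_class (n - 1)"
    by (rule RC_class_group_hom)
  \<comment> \<open>The sum is handled in the chain group, where the operation is \<open>+\<close>;
    the subgroup generated by \<open>?D\<close> is then carried to the quotient by the
    projection.\<close>
  let ?D = "{Poly_Mapping.single bs \<delta> | (bs :: 'a list) (\<delta> :: 'g). bs \<in> tuples (n - 1) \<and> 0 \<in> set bs}"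
  have D: "?D \<subseteq> carrier (chain_group (n - 1))" using single_in_chain_group by blast
  have "length as = n" "2 \<le> n" using assms by (auto simp: tuples_def)
  then obtain S where S: "S \<subseteq> {..<n}" "\<And>i. i \<in> S \<Longrightarrow> 0 \<in> set (face dot i as)"
    "(\<Sum>i<n. alt_sign i (Poly_Mapping.single (face dot i as) \<gamma>))
      = (\<Sum>i\<in>S. alt_sign i (Poly_Mapping.single (face dot i as) \<gamma>))"
    using sum_faces_degenerate[OF assms(1) _ _ assms(4), where G = "\<lambda>bs. Poly_Mapping.single bs \<gamma>"]
    by blast
  have "boundary dot n (Poly_Mapping.single as \<gamma>)
      = (\<Sum>i\<in>S. Poly_Mapping.single (face dot i as) (alt_sign i \<gamma>))"
    using assms S(3) by (simp add: boundary_single boundary_gen_faces single_alt_sign)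
  also have "\<dots> \<in> generate (chain_group (n - 1)) ?D"
  proof (rule subgroup_sum_closed[OF h.G.generate_is_subgroup[OF D]])
    fix i assume "i \<in> S"
    then have "face dot i as \<in> tuples (n - 1)" "0 \<in> set (face dot i as)"
      using S assms by (auto simp del: One_nat_def intro!: face_in_tuples)
    then show "Poly_Mapping.single (face dot i as) (alt_sign i \<gamma>)
        \<in> generate (chain_group (n - 1)) ?D"
      by (intro generate.incl) blast
  qed
  finally have "RC_class (n - 1) (boundary dot n (Poly_Mapping.single as \<gamma>))
      \<in> generate (RC_chains (n - 1)) (RC_class (n - 1) ` ?D)"
    unfolding h.generate_img[OF D] by (rule imageI)
  moreover have "RC_class (n - 1) ` ?D = RC_degenerate_gens (n - 1)" by blast
  ultimately show ?thesis by (simp only:)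
qed

lemma induced_boundary:
  assumes "linear_cycle_set dot" "n > 1"
  shows "\<exists>\<delta> \<in> hom (RC_chains n :: ('a::ab_group_add list \<Rightarrow>\<^sub>0 'g::ab_group_add) set monoid)
      (RC_chains (n - 1)).
    (\<forall>x \<in> carrier (chain_group n). \<delta> (RC_class n x) = RC_class (n - 1) (boundary dot n x)) \<and>
    \<delta> \<in> hom (RC_degenerate n) (RC_degenerate (n - 1))"
proof -
  obtain \<delta> where hom: "\<delta> \<in> hom (RC_chains n :: ('a list \<Rightarrow>\<^sub>0 'g) set monoid) (RC_chains (n - 1))"
    and \<delta>: "\<And>x. x \<in> carrier (chain_group n) \<Longrightarrow>
      \<delta> (RC_class n x) = RC_class (n - 1) (boundary dot n x)"
    \<comment> \<open>The universal property of the quotient supplies \<delta>.\<close>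
    using group_hom.FactGroup_universal_kernel[OF RC_class_boundary_hom[OF assms(2)]
        normal_RC_relations RC_relations_kernel[OF assms]]
    unfolding RC_class_def RC_chains_def by blast
  interpret \<delta>: group_hom "RC_chains n :: ('a list \<Rightarrow>\<^sub>0 'g) set monoid" "RC_chains (n - 1)" \<delta>
    by (intro group_hom.intro group_hom_axioms.intro group_RC_chains hom)
  let ?D = "generate (RC_chains n) (RC_degenerate_gens n :: ('a list \<Rightarrow>\<^sub>0 'g) set set)"
  let ?D' = "generate (RC_chains (n - 1)) (RC_degenerate_gens (n - 1) :: ('a list \<Rightarrow>\<^sub>0 'g) set set)"
  have "\<delta> ` RC_degenerate_gens n \<subseteq> ?D'"
    using boundary_degenerate[OF assms] by (auto simp: \<delta> single_in_chain_group)
  \<comment> \<open>The image of a generated subgroup is generated by the images of the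
    generators.\<close>
  then have "\<delta> ` ?D \<subseteq> ?D'"
    unfolding \<delta>.generate_img[OF RC_degenerate_gens_carrier, symmetric]
    by (intro \<delta>.H.generate_subgroup_incl \<delta>.H.generate_is_subgroup RC_degenerate_gens_carrier)
  moreover have "?D \<subseteq> carrier (RC_chains n)"
    by (rule \<delta>.G.generate_incl[OF RC_degenerate_gens_carrier])
  ultimately have "\<delta> \<in> hom (RC_degenerate n) (RC_degenerate (n - 1))"
    using hom_mult[OF hom]
    by (intro homI) (auto simp: RC_degenerate_def image_subset_iff subset_iff)
  then show ?thesis using hom \<delta> by blast
qed

section \<open>Cochains\<close>

lemma coboundary_coboundary:
  fixes f :: "'a::ab_group_add list \<Rightarrow> 'g::ab_group_add"
  assumes "linear_cycle_set dot" "n \<ge> 1"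
  shows "coboundary dot (n + 1) (coboundary dot n f) = \<one>\<^bsub>fun_group (n + 2)\<^esub>"
proof
  fix as :: "'a list"
  show "coboundary dot (n + 1) (coboundary dot n f) as = \<one>\<^bsub>fun_group (n + 2)\<^esub> as"
  proof (cases "as \<in> tuples (n + 2)")
    case True
    then have "coboundary dot (n + 1) (coboundary dot n f) as
        = (\<Sum>j<n+2. alt_sign j (coboundary dot n f (face dot j as)))"
      by (subst coboundary_faces) auto
    \<comment> \<open>The bound \<open>n+2-1\<close> is left unsimplified to match
      \<open>double_sum_faces\<close>.\<close>
    also have "\<dots> = (\<Sum>j<n+2. \<Sum>i<n+2-1. alt_sign j (alt_sign i (f (face dot i (face dot j as)))))"
    proof (rule sum.cong[OF refl])
      fix j assume "j \<in> {..<n+2}"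
      then have "face dot j as \<in> tuples (n + 1)"
        using face_in_tuples[OF True, of j dot] by auto
      then show "alt_sign j (coboundary dot n f (face dot j as))
          = (\<Sum>i<n+2-1. alt_sign j (alt_sign i (f (face dot i (face dot j as)))))"
        using assms by (subst coboundary_faces) (auto simp: alt_sign_sum alt_sign_add)
    qed
    also have "\<dots> = 0"
      using assms True by (intro double_sum_faces) (auto simp: tuples_def)
    finally show ?thesis using True by (simp add: fun_group_def)
  \<comment> \<open>Off \<open>tuples (n + 2)\<close> both sides are
    \<open>undefined\<close>.\<close>
  qed (simp add: coboundary_def fun_group_def)
qed

lemma coboundary_additive:
  fixes f :: "'a::ab_group_add list \<Rightarrow> 'g::ab_group_add"
  assumes "linear_cycle_set dot" "n \<ge> 1" "f \<in> carrier (RC_cochains n)"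
  shows "coboundary dot n f \<in> carrier (RC_cochains (n + 1))"
proof -
  have f: "f (bs @ [b + b']) = f (bs @ [b]) + f (bs @ [b'])" if "length bs + 1 = n" for bs b b'
    using assms that by (auto simp: RC_cochains_def)
  have "coboundary dot n f (as @ [a + a'])
      = coboundary dot n f (as @ [a]) + coboundary dot n f (as @ [a'])"
    if len: "length as + 1 = n + 1" for as a a'
  proof -
    have "f (face dot i (as @ [a + a'])) = f (face dot i (as @ [a])) + f (face dot i (as @ [a']))"
      if i: "i < n + 1" for i
    proof -
      obtain bs \<phi> where "length bs = length as - 1" "\<And>a a'. \<phi> (a + a') = \<phi> a + \<phi> a'"
          "\<And>a. face dot i (as @ [a]) = bs @ [\<phi> a]"
        using assms i len by (elim face_snoc[of dot as i]) auto
      moreover from this have "length bs + 1 = n" using assms len by auto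
      ultimately show ?thesis using f by simp
    qed
    then show ?thesis
      using assms(2) len
      by (simp add: coboundary_faces tuples_def alt_sign_add sum.distrib del: sum.lessThan_Suc)
  qed
  moreover have "coboundary dot n f \<in> carrier (fun_group (n + 1))"
    using assms hom_in_carrier[OF coboundary_hom[OF assms(2)]] by (auto simp: RC_cochains_def)
  ultimately show ?thesis by (simp add: RC_cochains_def)
qed

text \<open>After the cancellation in \<open>sum_faces_degenerate\<close>, \<open>f\<close> is
  evaluated only at tuples containing a zero, where it vanishes.\<close>

lemma coboundary_normalized:
  fixes f :: "'a::ab_group_add list \<Rightarrow> 'g::ab_group_add"
  assumes "linear_cycle_set dot" "n \<ge> 1" "f \<in> carrier (RC_normalized n)"
  shows "coboundary dot n f \<in> carrier (RC_normalized (n + 1))"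
proof -
  have "coboundary dot n f as = 0" if as: "as \<in> tuples (n + 1)" "0 \<in> set as" for as
  proof -
    have "length as = n + 1" "2 \<le> n + 1" using assms as by (auto simp: tuples_def)
    then obtain S where S: "S \<subseteq> {..<n+1}" "\<And>i. i \<in> S \<Longrightarrow> 0 \<in> set (face dot i as)"
      "(\<Sum>i<n+1. alt_sign i (f (face dot i as))) = (\<Sum>i\<in>S. alt_sign i (f (face dot i as)))"
      using sum_faces_degenerate[OF assms(1) _ _ as(2), where G = f] by blast
    have "f (face dot i as) = 0" if "i \<in> S" for i
    proof -
      have "face dot i as \<in> tuples (n + 1 - 1)"
        using that S(1) as assms by (intro face_in_tuples) auto
      then show ?thesis using assms S(2)[OF that] by (simp add: RC_normalized_def)
    qed
    then show ?thesis
      by (simp only: coboundary_faces[OF as(1) assms(2)] S(3) alt_sign_zero sum.neutral_const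
          cong: sum.cong)
  qed
  then show ?thesis
    using coboundary_additive[of dot n f] assms by (simp add: RC_normalized_def)
qed

text \<open>The operation is inherited from \<open>fun_group\<close>, so only preservation of the
  carrier is new.\<close>

lemma coboundary_hom_RC:
  fixes dot :: "'a::ab_group_add \<Rightarrow> 'a \<Rightarrow> 'a"
  assumes "linear_cycle_set dot" "n \<ge> 1"
  shows "coboundary dot n \<in>
    hom (RC_cochains n :: ('a list \<Rightarrow> 'g::ab_group_add) monoid) (RC_cochains (n + 1))"
  using coboundary_hom[OF assms(2), of dot] coboundary_additive[OF assms]
  by (auto simp: hom_def RC_cochains_def)

lemma coboundary_hom_RC_normalized:
  fixes dot :: "'a::ab_group_add \<Rightarrow> 'a \<Rightarrow> 'a"
  assumes "linear_cycle_set dot" "n \<ge> 1"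
  shows "coboundary dot n \<in>
    hom (RC_normalized n :: ('a list \<Rightarrow> 'g::ab_group_add) monoid) (RC_normalized (n + 1))"
  using coboundary_hom_RC[OF assms] coboundary_normalized[OF assms]
  by (auto simp: hom_def RC_normalized_def)

theorem proposition2p1:
  fixes dot :: "'a::ab_group_add \<Rightarrow> 'a \<Rightarrow> 'a"
  assumes "linear_cycle_set dot"
  shows
    "(\<forall>n>1. \<forall>x \<in> carrier (chain_group n :: ('a list \<Rightarrow>\<^sub>0 'g::ab_group_add) monoid).
        boundary dot (n - 1) (boundary dot n x) = 0) \<and>
     (\<forall>n>1. \<exists>\<delta> \<in> hom (RC_chains n :: ('a list \<Rightarrow>\<^sub>0 'g) set monoid) (RC_chains (n - 1)).
        (\<forall>x \<in> carrier (chain_group n).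
           \<delta> (RC_class n x) = RC_class (n - 1) (boundary dot n x)) \<and>
        \<delta> \<in> hom (RC_degenerate n) (RC_degenerate (n - 1))) \<and>
     (\<forall>n\<ge>1. \<forall>f \<in> carrier (fun_group n :: ('a list \<Rightarrow> 'g) monoid).
        coboundary dot (n + 1) (coboundary dot n f) = \<one>\<^bsub>fun_group (n + 2)\<^esub>) \<and>
     (\<forall>n\<ge>1. coboundary dot n \<in>
        hom (RC_cochains n :: ('a list \<Rightarrow> 'g) monoid) (RC_cochains (n + 1))) \<and>
     (\<forall>n\<ge>1. coboundary dot n \<in>
        hom (RC_normalized n :: ('a list \<Rightarrow> 'g) monoid) (RC_normalized (n + 1)))"
  using assms
  by (intro conjI allI impI ballI boundary_boundary induced_boundary coboundary_coboundary
      coboundary_hom_RC coboundary_hom_RC_normalized)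

end
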